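(* Let $a,b\ge 0$ and $c>0$ be real numbers, let $c_0:=\frac{a^2+b^2}{2(a+b)}$, and let $M:=\mathcal{M}^*(a,b,c)$, which is given explicitly by $M=\frac{a^2+b^2}{2c}$ if $c\le c_0$ and $M=|2c-a-b|+\sqrt{(2c-a-b)^2+(b-a)^2}$ if $c\ge c_0$. Define $G:[0,1]\to\mathbb{R}$ as follows. (1) Suppose $c\ge\frac{a+b}{2}$. Let $t_0=\frac12+\frac{b-a}{2M}$ and define $$G(t)=\begin{cases}\frac{M}{2}t^2+at & \text{if } 0\le t\le t_0,\\ -\frac{M}{2}t^2+(M+b)t+\left(c-b-\frac{M}{2}\right) & \text{if } t_0\le t\le 1.\end{cases}$$ (2) Suppose $c_0\le c\le\frac{a+b}{2}$. Let $\tilde t_0=\frac12-\frac{b-a}{2M}$ and define $$G(t)=\begin{cases}-\frac{M}{2}t^2+at & \text{if } 0\le t\le\tilde t_0,\\ \frac{M}{2}t^2+(b-M)t+\left(c-b+\frac{M}{2}\right) & \text{if } \tilde t_0\le t\le 1.\end{cases}$$ (3) Suppose $0<c<c_0$. Let $\tau_1=\frac{a}{M}$ and $\tau_2=1-\frac{b}{M}$, and define $$G(t)=\begin{cases}-\frac{M}{2}t^2+at & \text{if } 0\le t\le\tau_1,\\ \frac{a^2}{2M} & \text{if } \tau_1\le t\le\tau_2,\\ \frac{M}{2}(t-1)^2+b(t-1)+\frac{a^2+b^2}{2M} & \text{if } \tau_2\le t\le 1.\end{cases}$$ Then, in each case, $G\in C^{1,1}([0,1])$ is monotone increasing, $G(0)=0$,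 $G(1)=c$, $G'(0)=a$, $G'(1)=b$, and $$\|G''\|_{L^\infty([0,1])}=\mathcal{M}^*(a,b,c).$$
   Context: The convention $\frac{0}{0}=0$ and $\frac{\varepsilon}{0}=\infty$ for $\varepsilon>0$ is in force. "Monotone increasing" means $G'\ge 0$ (non-strict). $C^{1,1}([0,1])$ denotes the space of differentiable functions on $[0,1]$ with Lipschitz derivative (equivalently $W^{2,\infty}([0,1])$); $G''$ is understood in the sense of distributions. For real $a,b,c\ge 0$, $$\mathcal{M}^*(a,b,c):=\inf\left\{\|H''\|_{L^\infty([0,1])} : H\in C^{1,1}([0,1]),\ H(0)=0,\ H(1)=c,\ H'(0)=a,\ H'(1)=b,\ H'(x)\ge 0\ \forall x\in[0,1]\right\},$$ with the convention $\inf\varnothing=\infty$. *)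

theory Defs
  imports "HOL-Probability.Essential_Supremum"
begin

text \<open>Functions on \<open>[0,1]\<close> are represented by total functions on the reals; every notion below
  depends only on the values on \<open>[0,1]\<close>. In particular, derivatives at 0 and 1 are one-sided.\<close>

definition deriv01 :: "(real \<Rightarrow> real) \<Rightarrow> real \<Rightarrow> real" where
  "deriv01 H x = vector_derivative H (at x within {0..1})"

definition C11 :: "(real \<Rightarrow> real) \<Rightarrow> bool" where
  "C11 H \<longleftrightarrow> H differentiable_on {0..1} \<and> (\<exists>L. L-lipschitz_on {0..1} (deriv01 H))"

text \<open>The space of smooth functions with compact support in \<open>(0,1)\<close>.\<close>

definition test_function :: "(real \<Rightarrow> real) \<Rightarrow> bool" where
  "test_function \<phi> \<longleftrightarrow>
     (\<forall>n. (deriv ^^ n) \<phi> differentiable_on UNIV) \<and>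
     compact (closure {x. \<phi> x \<noteq> 0}) \<and> closure {x. \<phi> x \<noteq> 0} \<subseteq> {0<..<1}"

definition locally_integrable :: "(real \<Rightarrow> real) \<Rightarrow> bool" where
  "locally_integrable g \<longleftrightarrow> (\<forall>K. compact K \<and> K \<subseteq> {0<..<1} \<longrightarrow> set_integrable lborel K g)"

definition second_distributional_deriv :: "(real \<Rightarrow> real) \<Rightarrow> (real \<Rightarrow> real) \<Rightarrow> bool" where
  "second_distributional_deriv H g \<longleftrightarrow>
     locally_integrable g \<and>
     (\<forall>\<phi>. test_function \<phi> \<longrightarrow>
        (LINT t:{0<..<1}|lborel. H t * deriv (deriv \<phi>) t) =
        (LINT t:{0<..<1}|lborel. g t * \<phi> t))"

definition Linf_norm :: "(real \<Rightarrow> real) \<Rightarrow> ereal" where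
  "Linf_norm g = esssup (restrict_space lborel {0..1}) (\<lambda>t. ereal \<bar>g t\<bar>)"

text \<open>A function \<open>g\<close> representing the distribution \<open>H''\<close> is unique up to null sets, so the infimum
  ranges over at most one value; it is \<open>\<infinity>\<close> if \<open>H''\<close> is not represented by a function.\<close>

definition Linf_second_deriv :: "(real \<Rightarrow> real) \<Rightarrow> ereal" where
  "Linf_second_deriv H = Inf {Linf_norm g | g. second_distributional_deriv H g}"

definition admissible :: "real \<Rightarrow> real \<Rightarrow> real \<Rightarrow> (real \<Rightarrow> real) \<Rightarrow> bool" where
  "admissible a b c H \<longleftrightarrow>
     C11 H \<and> H 0 = 0 \<and> H 1 = c \<and> deriv01 H 0 = a \<and> deriv01 H 1 = b \<and>
     (\<forall>x\<in>{0..1}. deriv01 H x \<ge> 0)"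

definition Mstar :: "real \<Rightarrow> real \<Rightarrow> real \<Rightarrow> ereal" where
  "Mstar a b c = Inf {Linf_second_deriv H | H. admissible a b c H}"

text \<open>The candidate minimizers; \<open>M\<close> will be the value of \<open>Mstar a b c\<close>. The convention
  \<open>0/0 = 0\<close> matters when \<open>M = 0\<close>, i.e. \<open>a = b = c\<close>.\<close>

definition G_upper :: "real \<Rightarrow> real \<Rightarrow> real \<Rightarrow> real \<Rightarrow> real \<Rightarrow> real" where
  "G_upper M a b c t =
     (let t0 = 1/2 + (b - a) / (2 * M) in
      if t \<le> t0 then M/2 * t^2 + a * t
      else - (M/2) * t^2 + (M + b) * t + (c - b - M/2))"

definition G_middle :: "real \<Rightarrow> real \<Rightarrow> real \<Rightarrow> real \<Rightarrow> real \<Rightarrow> real" where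
  "G_middle M a b c t =
     (let t0 = 1/2 - (b - a) / (2 * M) in
      if t \<le> t0 then - (M/2) * t^2 + a * t
      else M/2 * t^2 + (b - M) * t + (c - b + M/2))"

definition G_lower :: "real \<Rightarrow> real \<Rightarrow> real \<Rightarrow> real \<Rightarrow> real" where
  "G_lower M a b t =
     (let \<tau>1 = a / M; \<tau>2 = 1 - b / M in
      if t \<le> \<tau>1 then - (M/2) * t^2 + a * t
      else if t \<le> \<tau>2 then a^2 / (2 * M)
      else M/2 * (t - 1)^2 + b * (t - 1) + (a^2 + b^2) / (2 * M))"

end

theory Submission
  imports Defs "HOL-Computational_Algebra.Polynomial"
begin

text \<open>
  Testing \<open>H''\<close> against smooth approximations of the indicator of \<open>[x, y]\<close> shows that
  a bound \<open>K\<close> on its \<open>L\<^sup>\<infinity>\<close> norm makes \<open>H'\<close> a \<open>K\<close>-Lipschitz function. Hence \<open>H s\<close> differs from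
  \<open>a s\<close> by at most \<open>K s\<^sup>2 / 2\<close> and \<open>H 1 - H s\<close> from \<open>b (1 - s)\<close> by at most \<open>K (1 - s)\<^sup>2 / 2\<close>.
  Adding the two at \<open>s = (1 \<plusminus> (b - a) / K) / 2\<close> gives the bound for large \<open>c\<close>. For small \<open>c\<close>, the choice
  \<open>s = a / (a + b)\<close> first gives \<open>K \<ge> a + b\<close>; then \<open>a / K \<le> 1 - b / K\<close>, and monotonicity between these
  two points gives \<open>c \<ge> (a\<^sup>2 + b\<^sup>2) / (2 K)\<close>. The functions \<open>G\<close> attain these bounds.
\<close>

section \<open>Smooth steps and test functions\<close>

lemma poly_mult_exp_minus_tendsto_0:
  "((\<lambda>u::real. poly q u * exp (- u)) \<longlongrightarrow> 0) at_top"
proof -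
  have "((\<lambda>u::real. \<Sum>i\<le>degree q. coeff q i * (u ^ i / exp u)) \<longlongrightarrow> (\<Sum>i\<le>degree q. coeff q i * 0)) at_top"
    by (intro tendsto_sum tendsto_mult tendsto_const tendsto_power_div_exp_0)
  moreover have "(\<lambda>u::real. \<Sum>i\<le>degree q. coeff q i * (u ^ i / exp u)) = (\<lambda>u. poly q u * exp (- u))"
    by (simp add: poly_altdef sum_distrib_right exp_minus divide_inverse mult.assoc)
  ultimately show ?thesis
    by simp
qed

text \<open>The case \<open>p = 1\<close> is the classical flat function exp(-1/x). The polynomial
  factor in 1/x makes the family closed under differentiation.\<close>

definition flat_exp :: "real poly \<Rightarrow> real \<Rightarrow> real" where
  "flat_exp p x = (if x > 0 then poly p (1/x) * exp (- (1/x)) else 0)"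

text \<open>With u = 1/x the chain rule contributes the factor -u^2, so p(u) exp(-u) has derivative
  u^2 (p(u) - p'(u)) exp(-u); \<open>[:0, 0, 1:]\<close> is the polynomial u^2. At 0 the exponential
  beats every polynomial.\<close>

lemma has_real_derivative_flat_exp:
  "(flat_exp p has_real_derivative flat_exp ([:0, 0, 1:] * (p - pderiv p)) x) (at x)"
proof -
  consider "x > 0" | "x < 0" | "x = 0" by linarith
  then show ?thesis
  proof cases
    case 1
    have "((\<lambda>x. poly p (1/x) * exp (- (1/x))) has_real_derivative
        flat_exp ([:0, 0, 1:] * (p - pderiv p)) x) (at x)"
      using 1 by (auto intro!: derivative_eq_intros DERIV_chain'[where g="poly p"] poly_DERIV
          simp: flat_exp_def field_simps power2_eq_square)
    then show ?thesis
      by (rule has_field_derivative_transform_within_open[where S="{0<..}"])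
        (use 1 in \<open>auto simp: flat_exp_def\<close>)
  next
    case 2
    have "((\<lambda>x. 0) has_real_derivative 0) (at x)" by simp
    then have "(flat_exp p has_real_derivative 0) (at x)"
      by (rule has_field_derivative_transform_within_open[where S="{..<0}"])
        (use 2 in \<open>auto simp: flat_exp_def\<close>)
    then show ?thesis
      using 2 by (simp add: flat_exp_def)
  next
    case 3
    \<comment> \<open>Under u = 1/h the difference quotient at 0 becomes u p(u) exp(-u);
      \<open>pCons 0 p\<close> is p multiplied by its variable.\<close>
    have "((\<lambda>h. poly (pCons 0 p) (inverse h) * exp (- inverse h)) \<longlongrightarrow> 0) (at_right 0)"
      by (rule filterlim_compose[OF poly_mult_exp_minus_tendsto_0 filterlim_inverse_at_top_right])
    then have R: "((\<lambda>h. flat_exp p h / h) \<longlongrightarrow> 0) (at_right 0)"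
      by (rule tendsto_cong[THEN iffD1, rotated])
        (auto simp: flat_exp_def field_simps eventually_at_right_less intro!: eventually_at_rightI[of 0 1])
    have L: "((\<lambda>h. flat_exp p h / h) \<longlongrightarrow> 0) (at_left 0)"
      by (rule tendsto_eventually) (auto simp: flat_exp_def intro!: eventually_at_leftI[of "-1"])
    show ?thesis
      using filterlim_split_at[OF L R] 3 by (simp add: DERIV_def flat_exp_def)
  qed
qed

text \<open>Smoothness of the elements comes for free, since the set is closed under differentiation.\<close>

inductive_set smooth_alg :: "(real \<Rightarrow> real) set" where
  flat: "(\<lambda>t. flat_exp p (\<alpha> * t + \<beta>)) \<in> smooth_alg"
| const: "(\<lambda>t. r) \<in> smooth_alg"
| add: "f \<in> smooth_alg \<Longrightarrow> g \<in> smooth_alg \<Longrightarrow> (\<lambda>t. f t + g t) \<in> smooth_alg"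
| mult: "f \<in> smooth_alg \<Longrightarrow> g \<in> smooth_alg \<Longrightarrow> (\<lambda>t. f t * g t) \<in> smooth_alg"
| inverse: "f \<in> smooth_alg \<Longrightarrow> (\<And>t. f t \<noteq> 0) \<Longrightarrow> (\<lambda>t. inverse (f t)) \<in> smooth_alg"

lemma smooth_alg_derivative:
  assumes "f \<in> smooth_alg"
  shows "\<exists>f'\<in>smooth_alg. \<forall>t. (f has_real_derivative f' t) (at t)"
  using assms
proof induction
  case (flat p \<alpha> \<beta>)
  let ?q = "[:0, 0, 1:] * (p - pderiv p)"
  have "((\<lambda>t. flat_exp p (\<alpha> * t + \<beta>)) has_real_derivative \<alpha> * flat_exp ?q (\<alpha> * t + \<beta>)) (at t)" for t
    by (rule DERIV_cong[OF DERIV_chain'[OF _ has_real_derivative_flat_exp]])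
      (auto intro!: derivative_eq_intros)
  moreover have "(\<lambda>t. \<alpha> * flat_exp ?q (\<alpha> * t + \<beta>)) \<in> smooth_alg"
    by (intro smooth_alg.intros)
  ultimately show ?case by (intro bexI allI)
next
  case (const r)
  show ?case
    by (rule bexI[where x="\<lambda>t. 0"]) (auto intro: smooth_alg.intros)
next
  case (add f g)
  then obtain f' g' where "f' \<in> smooth_alg" "g' \<in> smooth_alg"
    "\<And>t. (f has_real_derivative f' t) (at t)" "\<And>t. (g has_real_derivative g' t) (at t)"
    by blast
  then show ?case
    by (intro bexI[where x="\<lambda>t. f' t + g' t"]) (auto intro!: derivative_eq_intros smooth_alg.intros)
next
  case (mult f g)
  then obtain f' g' where "f' \<in> smooth_alg" "g' \<in> smooth_alg"
    "\<And>t. (f has_real_derivative f' t) (at t)" "\<And>t. (g has_real_derivative g' t) (at t)"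
    by blast
  with mult show ?case
    by (intro bexI[where x="\<lambda>t. f' t * g t + g' t * f t"] allI DERIV_mult smooth_alg.intros) auto
next
  case (inverse f)
  then obtain f' where f': "f' \<in> smooth_alg" "\<And>t. (f has_real_derivative f' t) (at t)"
    by blast
  \<comment> \<open>The derivative -f'/f^2 is spelled out with constants, products and inverses, the
    operations under which \<open>smooth_alg\<close> is generated.\<close>
  have "(\<lambda>t. (- 1) * (inverse (f t) * f' t * inverse (f t))) \<in> smooth_alg"
    using inverse f' by (intro smooth_alg.intros)
  moreover have "((\<lambda>t. inverse (f t)) has_real_derivative (- 1) * (inverse (f t) * f' t * inverse (f t))) (at t)" for t
    using DERIV_inverse'[OF f'(2), of t] inverse.hyps by simp
  ultimately show ?case by (intro bexI allI)
qed

lemma smooth_alg_deriv: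
  assumes "f \<in> smooth_alg"
  shows "deriv f \<in> smooth_alg" "(f has_real_derivative deriv f t) (at t)"
proof -
  obtain f' where f': "f' \<in> smooth_alg" "\<And>t. (f has_real_derivative f' t) (at t)"
    using smooth_alg_derivative[OF assms] by blast
  then have "deriv f = f'"
    by (auto intro: DERIV_imp_deriv)
  with f' show "deriv f \<in> smooth_alg" "(f has_real_derivative deriv f t) (at t)"
    by auto
qed

lemma smooth_alg_deriv_funpow:
  assumes "f \<in> smooth_alg"
  shows "(deriv ^^ n) f \<in> smooth_alg"
  using assms by (induction n) (auto intro: smooth_alg_deriv)

lemma smooth_alg_differentiable:
  assumes "f \<in> smooth_alg"
  shows "f differentiable_on UNIV"
  using smooth_alg_deriv(2)[OF assms]
  by (auto simp: differentiable_on_def real_differentiable_def)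

text \<open>The step is the quotient u/(u + v) of two flat functions: u vanishes exactly for t \<le>
  x and v exactly for t \<ge> x + d, so the denominator is never 0.\<close>

lemma smooth_step_exists:
  fixes x d :: real
  assumes "d > 0"
  obtains w where "w \<in> smooth_alg" "mono w" "\<And>t. t \<le> x \<Longrightarrow> w t = 0"
    "\<And>t. t \<ge> x + d \<Longrightarrow> w t = 1" "\<And>t. 0 \<le> w t" "\<And>t. w t \<le> 1"
proof -
  define u where "u t = flat_exp 1 (1/d * t + (- x/d))" for t
  define v where "v t = flat_exp 1 (-1/d * t + (1 + x/d))" for t
  have nn: "u t \<ge> 0" "v t \<ge> 0" for t
    by (auto simp: u_def v_def flat_exp_def)
  have u0: "u t = 0 \<longleftrightarrow> t \<le> x" for t
    using assms by (auto simp: u_def flat_exp_def field_simps)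
  have "-1/d * t + (1 + x/d) = (x + d - t) / d" for t
    using assms by (simp add: field_simps)
  then have v0: "v t = 0 \<longleftrightarrow> t \<ge> x + d" for t
    using assms by (auto simp: v_def flat_exp_def zero_less_divide_iff)
  have pos: "u t + v t > 0" for t
    using nn[of t] u0[of t] v0[of t] assms by (smt (verit))
  have flat_mono: "flat_exp 1 s \<le> flat_exp 1 t" if "s \<le> t" for s t
    using that by (auto simp: flat_exp_def field_simps)
  have um: "u s \<le> u t" if "s \<le> t" for s t
    unfolding u_def using that assms by (intro flat_mono) (auto simp: field_simps)
  have vm: "v t \<le> v s" if "s \<le> t" for s t
    unfolding v_def using that assms by (intro flat_mono) (auto simp: field_simps)
  define w where "w t = u t * inverse (u t + v t)" for t
  show ?thesis
  proof
    have "u \<in> smooth_alg" "v \<in> smooth_alg"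
      unfolding u_def v_def by (intro smooth_alg.intros)+
    then show "w \<in> smooth_alg"
      unfolding w_def using pos by (intro smooth_alg.intros) (auto simp: less_le)
    show "mono w"
    proof
      fix s t :: real assume "s \<le> t"
      \<comment> \<open>Cross-multiplication reduces w(s) \<le> w(t) to this inequality, which holds
        because u increases and v decreases.\<close>
      then have "u s * v t \<le> u t * v s"
        using um vm nn by (intro mult_mono) auto
      then show "w s \<le> w t"
        using pos[of s] pos[of t] by (simp add: w_def divide_inverse[symmetric] divide_simps algebra_simps)
    qed
    show "w t = 0" if "t \<le> x" for t using that u0 by (simp add: w_def)
    show "w t = 1" if "t \<ge> x + d" for t
      using v0[of t] pos[of t] that by (simp add: w_def)
    show "0 \<le> w t" for t using nn[of t] by (simp add: w_def)
    show "w t \<le> 1" for t using nn[of t] pos[of t] by (simp add: w_def divide_inverse[symmetric])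
  qed
qed

section \<open>Essential bounds and integration by parts against test functions\<close>

lemma admissibleD:
  assumes "admissible a b c H"
  shows "\<And>x. x \<in> {0..1} \<Longrightarrow> (H has_real_derivative deriv01 H x) (at x within {0..1})"
    and "\<exists>L. L-lipschitz_on {0..1} (deriv01 H)"
proof -
  show "(H has_real_derivative deriv01 H x) (at x within {0..1})" if "x \<in> {0..1}" for x
  proof -
    have "H differentiable (at x within {0..1})"
      using assms that by (auto simp: admissible_def C11_def differentiable_on_def)
    then show ?thesis
      by (simp add: deriv01_def vector_derivative_works has_real_derivative_iff_has_vector_derivative)
  qed
qed (use assms in \<open>auto simp: admissible_def C11_def\<close>)

lemma Linf_norm_leD:
  assumes "Linf_norm g \<le> ereal K"
  shows "AE t in lborel. t \<in> {0..1} \<longrightarrow> \<bar>g t\<bar> \<le> K"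
proof -
  have "AE t in restrict_space lborel {0..1}. ereal \<bar>g t\<bar> \<le> Linf_norm g"
    unfolding Linf_norm_def by (rule esssup_AE)
  then have "AE t in restrict_space lborel {0..1}. \<bar>g t\<bar> \<le> K"
    by eventually_elim (use assms in \<open>metis ereal_less_eq(3) order_trans\<close>)
  then show ?thesis
    by (simp add: AE_restrict_space_iff)
qed

text \<open>A bridge between the Lebesgue integral over the open interval, which defines
  distributional derivatives, and the gauge integral over the closed one, to which the fundamental
  theorem of calculus applies.\<close>

lemma LINT_Ioo_eq_integral:
  fixes f :: "real \<Rightarrow> real"
  assumes "set_integrable lborel {0..1} f"
  shows "(LINT t:{0<..<1}|lborel. f t) = integral {0..1} f"
proof -
  have "set_integrable lborel {0<..<1} f"
    by (rule set_integrable_subset[OF assms]) auto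
  then have "(LINT t:{0<..<1}|lborel. f t) = integral {0<..<1} f"
    by (rule set_borel_integral_eq_integral)
  then show ?thesis
    by (simp add: integral_open_interval_real)
qed

text \<open>The fundamental theorem of calculus for the product u v, which vanishes at both ends.
  The finite set \<open>S\<close> leaves room for the kinks in the derivatives of the candidate
  minimizers.\<close>

lemma has_integral_product_rule_0:
  fixes u u' v v' :: "real \<Rightarrow> real"
  assumes "finite S" and "continuous_on {0..1} u"
    and u': "\<And>t. t \<in> {0<..<1} - S \<Longrightarrow> (u has_real_derivative u' t) (at t)"
    and v': "\<And>t. (v has_real_derivative v' t) (at t)"
    and "v 0 = 0" "v 1 = 0"
  shows "((\<lambda>t. u t * v' t + u' t * v t) has_integral 0) {0..1}"
proof -
  have "continuous_on {0..1} v"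
    by (rule DERIV_continuous_on[OF has_field_derivative_at_within[OF v']])
  then have "((\<lambda>t. u t * v' t + u' t * v t) has_integral (u 1 * v 1 - u 0 * v 0)) {0..1}"
    by (intro fundamental_theorem_of_calculus_interior_strong[OF \<open>finite S\<close>] continuous_on_mult)
      (auto simp flip: has_real_derivative_iff_has_vector_derivative
        intro!: assms(2) DERIV_mult'[OF u' v'] )
  then show ?thesis
    using assms by simp
qed

text \<open>The complement of the closed support is an open neighbourhood of \<open>x\<close> on
  which \<phi> is constantly 0.\<close>

lemma test_function_boundary:
  assumes "test_function \<phi>" "x \<notin> {0<..<1}"
  shows "\<phi> x = 0" "deriv \<phi> x = 0"
proof -
  let ?U = "- closure {x. \<phi> x \<noteq> 0}"
  have U: "open ?U" "x \<in> ?U" "\<And>y. y \<in> ?U \<Longrightarrow> \<phi> y = 0"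
    using assms closure_subset[of "{x. \<phi> x \<noteq> 0}"] by (auto simp: test_function_def)
  show "\<phi> x = 0"
    by (rule U(3)[OF U(2)])
  have "((\<lambda>t. 0) has_real_derivative 0) (at x)" by simp
  then have "(\<phi> has_real_derivative 0) (at x)"
    by (rule has_field_derivative_transform_within_open[OF _ U(1,2)]) (rule U(3)[symmetric])
  then show "deriv \<phi> x = 0"
    by (rule DERIV_imp_deriv)
qed

lemma test_function_derivative:
  assumes "test_function \<phi>"
  shows "((deriv ^^ n) \<phi> has_real_derivative (deriv ^^ Suc n) \<phi> t) (at t)"
proof -
  have "(deriv ^^ n) \<phi> field_differentiable at t"
    using assms
    by (auto simp: test_function_def differentiable_on_def field_differentiable_def real_differentiable_def)
  then show ?thesis
    by (simp add: DERIV_deriv_iff_field_differentiable)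
qed

lemma test_function_derivs:
  assumes "test_function \<phi>"
  shows "(\<phi> has_real_derivative deriv \<phi> t) (at t)"
    and "(deriv \<phi> has_real_derivative deriv (deriv \<phi>) t) (at t)"
    and "continuous_on A \<phi>" "continuous_on A (deriv \<phi>)" "continuous_on A (deriv (deriv \<phi>))"
proof -
  note D = test_function_derivative[OF assms]
  show "(\<phi> has_real_derivative deriv \<phi> t) (at t)"
    and "(deriv \<phi> has_real_derivative deriv (deriv \<phi>) t) (at t)"
    using D[of 0 t] D[of 1 t] by auto
  have "continuous_on A ((deriv ^^ n) \<phi>)" for n
    by (rule DERIV_continuous_on[OF has_field_derivative_at_within[OF D]])
  from this[of 0] this[of 1] this[of 2]
  show "continuous_on A \<phi>" "continuous_on A (deriv \<phi>)" "continuous_on A (deriv (deriv \<phi>))"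
    by (auto simp: numeral_2_eq_2)
qed

text \<open>One integration by parts. It serves both directions: to extract a Lipschitz bound from a
  given second derivative, and to verify the second derivative of a candidate.\<close>

lemma integral_second_deriv_test_function:
  fixes H p :: "real \<Rightarrow> real"
  assumes H: "\<And>x. x \<in> {0..1} \<Longrightarrow> (H has_real_derivative p x) (at x within {0..1})"
    and p: "continuous_on {0..1} p" and \<phi>: "test_function \<phi>"
  shows "(LINT t:{0<..<1}|lborel. H t * deriv (deriv \<phi>) t) = - integral {0..1} (\<lambda>t. p t * deriv \<phi> t)"
proof -
  note D = test_function_derivs[OF \<phi>]
  have cH: "continuous_on {0..1} H"
    by (rule DERIV_continuous_on[OF H])
  have H': "(H has_real_derivative p x) (at x)" if "x \<in> {0<..<1}" for x
    using H[of x] that at_within_interior[of x "{0..1}"] by auto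
  have "((\<lambda>t. H t * deriv (deriv \<phi>) t + p t * deriv \<phi> t) has_integral 0) {0..1}"
    by (rule has_integral_product_rule_0[where S="{}"])
      (auto intro: cH H' D simp: test_function_boundary[OF \<phi>])
  moreover have "continuous_on {0..1} (\<lambda>t. H t * deriv (deriv \<phi>) t)"
    by (intro continuous_on_mult cH D)
  moreover have "continuous_on {0..1} (\<lambda>t. p t * deriv \<phi> t)"
    by (intro continuous_on_mult p D)
  ultimately have "integral {0..1} (\<lambda>t. H t * deriv (deriv \<phi>) t) + integral {0..1} (\<lambda>t. p t * deriv \<phi> t) = 0"
    by (subst integral_add[symmetric]) (auto simp: integral_unique intro!: integrable_continuous_real)
  moreover have "(LINT t:{0<..<1}|lborel. H t * deriv (deriv \<phi>) t) = integral {0..1} (\<lambda>t. H t * deriv (deriv \<phi>) t)"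
    by (intro LINT_Ioo_eq_integral borel_integrable_atLeastAtMost' continuous_on_mult cH D)
  ultimately show ?thesis by simp
qed

text \<open>The derivative of the step is a nonnegative density of total mass 1 concentrated on
  [x, x + d], a smoothed Dirac mass. The integral is thus an average of values of \<open>p\<close>
  that differ from \<open>p x\<close> by at most \<open>L * d\<close>.\<close>

lemma integral_against_step_derivative:
  fixes p w :: "real \<Rightarrow> real"
  assumes lip: "L-lipschitz_on {0..1} p" and "0 \<le> x" "x + d \<le> 1" "d > 0"
    and w: "w \<in> smooth_alg" "mono w" "\<And>t. t \<le> x \<Longrightarrow> w t = 0" "\<And>t. t \<ge> x + d \<Longrightarrow> w t = 1"
  shows "\<bar>integral {0..1} (\<lambda>t. p t * deriv w t) - p x\<bar> \<le> L * d"
    "(\<lambda>t. p t * deriv w t) integrable_on {0..1}"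
proof -
  note D = smooth_alg_deriv[OF w(1)]
  have cp: "continuous_on {0..1} p"
    by (rule lipschitz_on_continuous_on[OF lip])
  have cw: "continuous_on {0..1} (deriv w)"
    by (rule DERIV_continuous_on[OF has_field_derivative_at_within[OF smooth_alg_deriv(2)[OF D(1)]]])
  show int: "(\<lambda>t. p t * deriv w t) integrable_on {0..1}"
    by (intro integrable_continuous_real continuous_on_mult cp cw)
  have "(deriv w has_integral (w 1 - w 0)) {0..1}"
    by (rule fundamental_theorem_of_calculus)
      (simp_all add: has_field_derivative_at_within[OF D(2)] flip: has_real_derivative_iff_has_vector_derivative)
  then have w1: "(deriv w has_integral 1) {0..1}"
    using w assms by simp
  have nonneg: "deriv w t \<ge> 0" for t
    by (rule mono_on_imp_deriv_nonneg[of UNIV w, OF _ D(2)]) (use w in auto)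
  have zero: "deriv w t = 0" if "t < x \<or> t > x + d" for t
  proof -
    define C where "C = (if t < x then {..<x} else {x + d<..})"
    have "open C" "t \<in> C" "\<And>s. s \<in> C \<Longrightarrow> w t = w s"
      using that w(3,4) \<open>d > 0\<close> by (auto simp: C_def)
    moreover have "((\<lambda>s. w t) has_real_derivative 0) (at t)"
      by simp
    ultimately have "(w has_real_derivative 0) (at t)"
      using has_field_derivative_transform_within_open by blast
    then show ?thesis
      by (rule DERIV_imp_deriv)
  qed
  have "norm (integral {0..1} (\<lambda>t. (p t - p x) * deriv w t)) \<le> integral {0..1} (\<lambda>t. L * d * deriv w t)"
  proof (rule Henstock_Kurzweil_Integration.integral_norm_bound_integral)
    show "(\<lambda>t. (p t - p x) * deriv w t) integrable_on {0..1}"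
      by (intro integrable_continuous_real continuous_intros cp cw)
    show "(\<lambda>t. L * d * deriv w t) integrable_on {0..1}"
      by (intro integrable_continuous_real continuous_intros cp cw)
    fix t :: real assume t: "t \<in> {0..1}"
    show "norm ((p t - p x) * deriv w t) \<le> L * d * deriv w t"
    proof (cases "t < x \<or> t > x + d")
      case True
      with zero show ?thesis by simp
    next
      case False
      have "\<bar>p t - p x\<bar> \<le> L * \<bar>t - x\<bar>"
        using lipschitz_onD[OF lip t, of x] assms by (auto simp: dist_real_def)
      also have "\<dots> \<le> L * d"
        using False lipschitz_on_nonneg[OF lip] by (intro mult_left_mono) auto
      finally show ?thesis
        using nonneg[of t] by (simp add: abs_mult mult_right_mono)
    qed
  qed
  moreover have "integral {0..1} (\<lambda>t. L * d * deriv w t) = L * d"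
    by (rule integral_unique[OF has_integral_mult_right[OF w1, of "L * d"], unfolded mult_1_right])
  moreover have "integral {0..1} (\<lambda>t. (p t - p x) * deriv w t) = integral {0..1} (\<lambda>t. p t * deriv w t) - p x"
  proof -
    have "((\<lambda>t. p t * deriv w t - p x * deriv w t) has_integral
        (integral {0..1} (\<lambda>t. p t * deriv w t) - p x * 1)) {0..1}"
      by (intro has_integral_diff has_integral_mult_right w1 integrable_integral int)
    then show ?thesis
      by (simp add: integral_unique left_diff_distrib)
  qed
  ultimately show "\<bar>integral {0..1} (\<lambda>t. p t * deriv w t) - p x\<bar> \<le> L * d"
    by (metis real_norm_def)
qed

lemma test_functionI:
  assumes "\<phi> \<in> smooth_alg" and "0 < x" "y < 1" and "\<And>t. t \<notin> {x..y} \<Longrightarrow> \<phi> t = 0"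
  shows "test_function \<phi>"
proof -
  have "{t. \<phi> t \<noteq> 0} \<subseteq> {x..y}"
    using assms(4) by blast
  then have sub: "closure {t. \<phi> t \<noteq> 0} \<subseteq> {x..y}"
    by (rule closure_minimal) simp
  then have "bounded (closure {t. \<phi> t \<noteq> 0})"
    using bounded_closed_interval bounded_subset by blast
  then have "compact (closure {t. \<phi> t \<noteq> 0})"
    by (simp add: compact_eq_bounded_closed)
  with sub show ?thesis
    using assms smooth_alg_differentiable[OF smooth_alg_deriv_funpow[OF assms(1)]]
    by (auto simp: test_function_def)
qed

lemma LINT_mult_bound:
  fixes g \<phi> :: "real \<Rightarrow> real"
  assumes g: "AE t in lborel. t \<in> {0..1} \<longrightarrow> \<bar>g t\<bar> \<le> K"
    and \<phi>: "\<And>t. 0 \<le> \<phi> t" "\<And>t. \<phi> t \<le> 1" "\<And>t. t \<notin> {x..y} \<Longrightarrow> \<phi> t = 0" and "0 \<le> x" "x \<le> y" "y \<le> 1" "0 \<le> K"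
  shows "\<bar>LINT t:{0<..<1}|lborel. g t * \<phi> t\<bar> \<le> K * (y - x)"
proof (cases "integrable lborel (\<lambda>t. indicator {0<..<1} t *\<^sub>R (g t * \<phi> t))")
  case True
  have "\<bar>LINT t:{0<..<1}|lborel. g t * \<phi> t\<bar> \<le> (LINT t|lborel. \<bar>indicator {0<..<1} t *\<^sub>R (g t * \<phi> t)\<bar>)"
    unfolding set_lebesgue_integral_def by (rule integral_abs_bound)
  also have "\<dots> \<le> (LINT t|lborel. K * indicator {x..y} t)"
  proof (rule integral_mono_AE)
    show "AE t in lborel. \<bar>indicator {0<..<1} t *\<^sub>R (g t * \<phi> t)\<bar> \<le> K * indicator {x..y} t"
      using g
    proof eventually_elim
      case (elim t)
      show ?case
      proof (cases "t \<in> {0<..<1} \<inter> {x..y}")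
        case True
        then have "\<bar>g t\<bar> * \<bar>\<phi> t\<bar> \<le> K * 1"
          using elim \<phi>[of t] assms by (intro mult_mono) auto
        with True show ?thesis by (simp add: abs_mult)
      qed (use \<phi> \<open>0 \<le> K\<close> in \<open>auto simp: indicator_def\<close>)
    qed
  qed (use True assms in \<open>auto intro!: integrable_real_mult_indicator integrable_mult_right\<close>)
  also have "\<dots> = K * (y - x)"
    using assms by simp
  finally show ?thesis .
next
  \<comment> \<open>The integral of a non-integrable function is 0 by default, and the right-hand
    side is nonnegative.\<close>
  case False
  then show ?thesis
    using assms by (simp add: set_lebesgue_integral_def not_integrable_integral_eq)
qed

text \<open>The test function is a step at x minus a step at y. Pairing it with \<open>g\<close>
  costs at most K times the length of its support, while pairing its derivative with
  \<open>p\<close> gives p(x) - p(y) up to the error 2 L d. The given constant \<open>L\<close>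
  enters only through this error and disappears as d tends to 0.\<close>

lemma lipschitz_of_second_distributional_deriv:
  fixes H p g :: "real \<Rightarrow> real"
  assumes H: "\<And>x. x \<in> {0..1} \<Longrightarrow> (H has_real_derivative p x) (at x within {0..1})"
    and lip: "L-lipschitz_on {0..1} p"
    and sd: "second_distributional_deriv H g" and norm: "Linf_norm g \<le> ereal K"
  shows "K-lipschitz_on {0..1} p"
proof -
  have cp: "continuous_on {0..1} p"
    by (rule lipschitz_on_continuous_on[OF lip])
  have gK: "AE t in lborel. t \<in> {0..1} \<longrightarrow> \<bar>g t\<bar> \<le> K"
    by (rule Linf_norm_leD[OF norm])
  \<comment> \<open>A negative \<open>K\<close> would make the unit interval a null set.\<close>
  have "K \<ge> 0"
  proof (rule ccontr)
    assume "\<not> K \<ge> 0"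
    then have "AE t in lborel. t \<notin> {0..1::real}"
      using gK by (auto elim!: eventually_mono)
    then have "emeasure lborel {0..1::real} = 0"
      by (subst (asm) AE_iff_measurable[of "{0..1}"]) auto
    then show False by simp
  qed
  have approx: "\<bar>p y - p x\<bar> \<le> K * (y + d - x) + 2 * L * d"
    if xy: "0 < x" "x < y" "y + d < 1" "d > 0" "x + d < y" for x y d
  proof -
    obtain w where w: "w \<in> smooth_alg" "mono w" "\<And>t. t \<le> x \<Longrightarrow> w t = 0"
      "\<And>t. t \<ge> x + d \<Longrightarrow> w t = 1" "\<And>t. 0 \<le> w t" "\<And>t. w t \<le> 1"
      using smooth_step_exists[OF \<open>d > 0\<close>, of x] by blast
    obtain z where z: "z \<in> smooth_alg" "mono z" "\<And>t. t \<le> y \<Longrightarrow> z t = 0"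
      "\<And>t. t \<ge> y + d \<Longrightarrow> z t = 1" "\<And>t. 0 \<le> z t" "\<And>t. z t \<le> 1"
      using smooth_step_exists[OF \<open>d > 0\<close>, of y] by blast
    define \<phi> where "\<phi> t = w t + (- 1) * z t" for t
    have "\<phi> \<in> smooth_alg"
      unfolding \<phi>_def by (intro smooth_alg.intros w z)
    moreover have supp: "\<phi> t = 0" if "t \<notin> {x..y+d}" for t
      using that xy w(3,4)[of t] z(3,4)[of t] by (auto simp: \<phi>_def)
    ultimately have \<phi>: "test_function \<phi>"
      using xy by (intro test_functionI[of _ x "y + d"]) auto
    \<comment> \<open>Up to \<open>y\<close> the second step is 0; beyond \<open>y\<close> the first
      has already reached 1, because \<open>x + d < y\<close>.\<close>
    have bds: "0 \<le> \<phi> t" "\<phi> t \<le> 1" for t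
      using w(4-6)[of t] z(3,5,6)[of t] xy by (cases "t \<le> y"; auto simp: \<phi>_def)+
    have bounds: "0 \<le> x" "x + d \<le> 1" "0 \<le> y" "y + d \<le> 1"
      using xy by auto
    have iw: "\<bar>integral {0..1} (\<lambda>t. p t * deriv w t) - p x\<bar> \<le> L * d"
      "(\<lambda>t. p t * deriv w t) integrable_on {0..1}"
      by (rule integral_against_step_derivative[OF lip bounds(1,2) \<open>d > 0\<close> w(1-4)]; assumption)+
    have iz: "\<bar>integral {0..1} (\<lambda>t. p t * deriv z t) - p y\<bar> \<le> L * d"
      "(\<lambda>t. p t * deriv z t) integrable_on {0..1}"
      by (rule integral_against_step_derivative[OF lip bounds(3,4) \<open>d > 0\<close> z(1-4)]; assumption)+
    have "\<bar>integral {0..1} (\<lambda>t. p t * deriv \<phi> t)\<bar> \<le> K * (y + d - x)"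
    proof -
      have "\<bar>LINT t:{0<..<1}|lborel. g t * \<phi> t\<bar> \<le> K * (y + d - x)"
        by (rule LINT_mult_bound[OF gK bds supp]) (use xy \<open>K \<ge> 0\<close> in auto)
      then show ?thesis
        using integral_second_deriv_test_function[OF H cp \<phi>] sd \<phi>
        by (auto simp: second_distributional_deriv_def)
    qed
    moreover have "integral {0..1} (\<lambda>t. p t * deriv \<phi> t) =
       integral {0..1} (\<lambda>t. p t * deriv w t) - integral {0..1} (\<lambda>t. p t * deriv z t)"
    proof -
      have "deriv \<phi> t = deriv w t - deriv z t" for t
        unfolding \<phi>_def
        by (rule DERIV_imp_deriv) (auto intro!: derivative_eq_intros smooth_alg_deriv(2) w z)
      then show ?thesis
        using iw(2) iz(2) by (simp add: right_diff_distrib Henstock_Kurzweil_Integration.integral_diff)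
    qed
    ultimately show ?thesis
      using iw(1) iz(1) by (simp add: abs_le_iff)
  qed
  \<comment> \<open>Let d tend to 0. Test functions only reach interior points, so the end points
    are added afterwards by continuity of \<open>p\<close>.\<close>
  have "\<bar>p y - p x\<bar> \<le> K * (y - x)" if xy: "0 < x" "x < y" "y < 1" for x y
  proof (rule tendsto_lowerbound[where F="at_right 0"])
    have "((\<lambda>d. K * (y + d - x) + 2 * L * d) \<longlongrightarrow> K * (y + 0 - x) + 2 * L * 0) (at_right 0)"
      by (intro tendsto_intros)
    then show "((\<lambda>d. K * (y + d - x) + 2 * L * d) \<longlongrightarrow> K * (y - x)) (at_right 0)"
      by simp
    show "\<forall>\<^sub>F d in at_right 0. \<bar>p y - p x\<bar> \<le> K * (y + d - x) + 2 * L * d"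
      using xy by (intro eventually_at_rightI[of 0 "min (1 - y) (y - x)"] approx) auto
  qed simp
  then have "\<bar>p x - p y\<bar> \<le> K * \<bar>x - y\<bar>" if "0 < x" "x \<le> y" "y < 1" for x y
    using that by (cases "x = y") (force simp: abs_minus_commute)+
  then have "K-lipschitz_on {0<..<1} p"
    by (intro lipschitz_on_leI \<open>K \<ge> 0\<close>) (simp add: dist_real_def)
  then show ?thesis
    using lipschitz_on_closure[of K "{0<..<1}" p] cp by simp
qed

section \<open>Lower bounds\<close>

text \<open>First-order Taylor estimate with a quadratic remainder, proved by monotonicity: the
  auxiliary function \<open>F\<close> increases before u and decreases after u, hence is largest at
  u.\<close>

lemma lipschitz_derivative_quadratic_bounds:
  fixes H p :: "real \<Rightarrow> real"
  assumes H: "\<And>x. x \<in> {0..1} \<Longrightarrow> (H has_real_derivative p x) (at x within {0..1})"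
    and lip: "K-lipschitz_on {0..1} p" and u: "u \<in> {0..1}" and v: "v \<in> {0..1}"
  shows "\<bar>H v - H u - p u * (v - u)\<bar> \<le> K / 2 * (v - u)^2"
proof -
  have bound: "\<bar>p t - p u\<bar> \<le> K * \<bar>t - u\<bar>" if "t \<in> {0..1}" for t
    using lipschitz_onD[OF lip that u] by (simp add: dist_real_def)
  \<comment> \<open>The sign \<open>s\<close> selects one of the two inequalities hidden in the
    absolute value.\<close>
  have "s * (H v - H u - p u * (v - u)) \<le> K / 2 * (v - u)^2" if s: "s = 1 \<or> s = -1" for s
  proof -
    define F where "F t = s * (H t - p u * (t - u)) - K / 2 * (t - u)^2" for t
    have dF: "(F has_real_derivative s * (p t - p u) - K * (t - u)) (at t within A)"
      if "t \<in> {0..1}" "A \<subseteq> {0..1}" for t A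
      unfolding F_def using DERIV_subset[OF H[OF that(1)] that(2)]
      by (auto intro!: derivative_eq_intros)
    have cont: "continuous_on A F" if "A \<subseteq> {0..1}" for A
      using that by (auto intro!: DERIV_continuous_on dF)
    have der: "(F has_real_derivative s * (p t - p u) - K * (t - u)) (at t)" if "t \<in> {0<..<1}" for t
      using that dF[OF _ greaterThanLessThan_subseteq_atLeastAtMost_iff[THEN iffD2], of t 0 1]
        at_within_open[of t "{0<..<1}"] by auto
    have "F v \<le> F u"
    proof (cases "u \<le> v")
      case True
      then show ?thesis
      proof (rule DERIV_nonpos_imp_decreasing_open)
        fix t assume t: "u < t" "t < v"
        then have "s * (p t - p u) - K * (t - u) \<le> 0"
          using bound[of t] u v s by auto
        then show "\<exists>y. (F has_real_derivative y) (at t) \<and> y \<le> 0"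
          using der[of t] t u v by auto
      qed (use u v in \<open>auto intro!: cont\<close>)
    next
      case False
      then have "v \<le> u" by simp
      then show ?thesis
      proof (rule DERIV_nonneg_imp_increasing_open)
        fix t assume t: "v < t" "t < u"
        then have "s * (p t - p u) - K * (t - u) \<ge> 0"
          using bound[of t] u v s by (auto simp: algebra_simps)
        then show "\<exists>y. (F has_real_derivative y) (at t) \<and> y \<ge> 0"
          using der[of t] t u v by auto
      qed (use u v in \<open>auto intro!: cont\<close>)
    qed
    then show ?thesis
      by (simp add: F_def algebra_simps)
  qed
  from this[of 1] this[of "-1"] show ?thesis
    by (simp only: abs_le_iff mult_1_left mult_minus1 simp_thms)
qed


text \<open>The Taylor estimate from the left end covers [0, s], the one from the right end covers
  [s, 1], and H(s) cancels in the sum. The point s is left free for later optimization.\<close>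

lemma lipschitz_derivative_split_bound:
  fixes H p :: "real \<Rightarrow> real"
  assumes H: "\<And>x. x \<in> {0..1} \<Longrightarrow> (H has_real_derivative p x) (at x within {0..1})"
    and lip: "K-lipschitz_on {0..1} p" and s: "s \<in> {0..1}"
  shows "\<bar>H 1 - H 0 - p 0 * s - p 1 * (1 - s)\<bar> \<le> K / 2 * (s^2 + (1 - s)^2)"
proof -
  have "\<bar>H s - H 0 - p 0 * s\<bar> \<le> K / 2 * s^2"
    using lipschitz_derivative_quadratic_bounds[OF H lip, of 0 s] s by simp
  moreover have "\<bar>H s - H 1 - p 1 * (s - 1)\<bar> \<le> K / 2 * (s - 1)^2"
    using lipschitz_derivative_quadratic_bounds[OF H lip, of 1 s] s by simp
  moreover have "(s - 1)^2 = (1 - s)^2" "p 1 * (s - 1) = - (p 1 * (1 - s))"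
    by (simp_all add: power2_commute algebra_simps)
  ultimately show ?thesis
    by (simp only: distrib_left)
qed

text \<open>Splitting at (1 + \<sigma>)/2 and choosing \<sigma> = d/K or -d/K leads to K^2 - 2 |e| K
  - d^2 \<ge> 0. Since also K \<ge> |e|, the number K is at least the larger root of this quadratic,
  which is the claimed bound.\<close>

lemma lipschitz_derivative_lower_bound_large:
  fixes H p :: "real \<Rightarrow> real"
  assumes H: "\<And>x. x \<in> {0..1} \<Longrightarrow> (H has_real_derivative p x) (at x within {0..1})"
    and lip: "K-lipschitz_on {0..1} p"
    and e: "e = 2 * (H 1 - H 0) - p 0 - p 1" and d: "d = p 1 - p 0"
  shows "\<bar>e\<bar> + sqrt (e^2 + d^2) \<le> K"
proof -
  have "\<bar>d\<bar> \<le> K"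
    using lipschitz_onD[OF lip, of 1 0] by (simp add: d dist_real_def)
  have key: "\<bar>e + d * \<sigma>\<bar> \<le> K * (1 + \<sigma>^2) / 2" if "\<bar>\<sigma>\<bar> \<le> 1" for \<sigma>
  proof -
    have "\<bar>H 1 - H 0 - p 0 * ((1 + \<sigma>) / 2) - p 1 * (1 - (1 + \<sigma>) / 2)\<bar>
        \<le> K / 2 * (((1 + \<sigma>) / 2)^2 + (1 - (1 + \<sigma>) / 2)^2)"
      using that by (intro lipschitz_derivative_split_bound[OF H lip]) auto
    moreover have "H 1 - H 0 - p 0 * ((1 + \<sigma>) / 2) - p 1 * (1 - (1 + \<sigma>) / 2) = (e + d * \<sigma>) / 2"
      by (simp add: e d field_simps)
    moreover have "K / 2 * (((1 + \<sigma>) / 2)^2 + (1 - (1 + \<sigma>) / 2)^2) = K * (1 + \<sigma>^2) / 4"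
      by (simp add: field_simps power2_eq_square)
    ultimately have "\<bar>(e + d * \<sigma>) / 2\<bar> \<le> K * (1 + \<sigma>^2) / 4"
      by (simp only:)
    then show ?thesis by simp
  qed
  show ?thesis
  proof (cases "K = 0")
    \<comment> \<open>Here \<open>d = 0\<close>, and \<open>key\<close> at 0 gives
      \<open>e = 0\<close>.\<close>
    case True
    then show ?thesis
      using key[of 0] \<open>\<bar>d\<bar> \<le> K\<close> by simp
  next
    case False
    then have "K > 0"
      using \<open>\<bar>d\<bar> \<le> K\<close> by linarith
    \<comment> \<open>The value d/K maximizes d \<sigma> - K \<sigma>^2 / 2; the opposite value does
      the same for the inequality with reversed sign.\<close>
    have "\<bar>d / K\<bar> \<le> 1" "\<bar>- d / K\<bar> \<le> 1"
      using \<open>\<bar>d\<bar> \<le> K\<close> \<open>K > 0\<close> by (auto simp: abs_if field_simps split: if_splits)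
    moreover have "K * (1 + (d / K)^2) / 2 = (K + d^2 / K) / 2" "K * (1 + (- d / K)^2) / 2 = (K + d^2 / K) / 2"
      "d * (d / K) = d^2 / K" "d * (- d / K) = - (d^2 / K)"
      using \<open>K > 0\<close> by (simp_all add: power2_eq_square field_simps)
    ultimately
    have "\<bar>e + d^2 / K\<bar> \<le> (K + d^2 / K) / 2" "\<bar>e - d^2 / K\<bar> \<le> (K + d^2 / K) / 2"
      using key[of "d / K"] key[of "- d / K"] by (simp_all add: power2_eq_square)
    then have "\<bar>e\<bar> + d^2 / K \<le> (K + d^2 / K) / 2"
      by linarith
    \<comment> \<open>Stated for arbitrary reals, so that the quotient \<open>d^2 / K\<close> is
      substituted as a whole and not rewritten by the simplifier.\<close>
    moreover have "2 * x + y \<le> z" if "x + y \<le> (z + y) / 2" for x y z :: real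
      using that by simp
    ultimately have "2 * \<bar>e\<bar> + d^2 / K \<le> K"
      by blast
    then have "(2 * \<bar>e\<bar> + d^2 / K) * K \<le> K * K"
      by (rule mult_right_mono) (use \<open>K > 0\<close> in simp)
    moreover have "(2 * \<bar>e\<bar> + d^2 / K) * K = 2 * \<bar>e\<bar> * K + d^2"
      using \<open>K > 0\<close> by (simp add: distrib_right)
    ultimately have *: "2 * \<bar>e\<bar> * K + d^2 \<le> K^2"
      by (simp only: power2_eq_square)
    then have "2 * \<bar>e\<bar> * K \<le> K * K"
      using zero_le_power2[of d] by (simp only: power2_eq_square)
    \<comment> \<open>This makes K - |e| nonnegative, so that it can be compared with the square
      root through squares.\<close>
    then have "2 * \<bar>e\<bar> \<le> K"
      using \<open>K > 0\<close> by (simp only: mult_le_cancel_right_pos)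
    moreover have "e^2 + d^2 \<le> (K - \<bar>e\<bar>)^2"
      using * by (simp add: power2_diff algebra_simps)
    ultimately have "sqrt (e^2 + d^2) \<le> K - \<bar>e\<bar>"
      by (intro real_le_lsqrt) auto
    then show ?thesis by simp
  qed
qed

text \<open>Splitting at a/(a + b) gives r - c \<le> K r / (2 (a + b)) with r = (a^2 + b^2)/(a + b);
  as c \<le> r/2, this forces K \<ge> a + b. Then [0, a/K] and [1 - b/K, 1] do not overlap: H gains
  at least a^2/(2K) on the first and b^2/(2K) on the second, and loses nothing in between.\<close>

lemma lipschitz_derivative_lower_bound_small:
  fixes H p :: "real \<Rightarrow> real"
  assumes H: "\<And>x. x \<in> {0..1} \<Longrightarrow> (H has_real_derivative p x) (at x within {0..1})"
    and lip: "K-lipschitz_on {0..1} p" and nonneg: "\<And>x. x \<in> {0..1} \<Longrightarrow> 0 \<le> p x"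
    and c: "c = H 1 - H 0" "0 < c" "c \<le> ((p 0)^2 + (p 1)^2) / (2 * (p 0 + p 1))"
  shows "((p 0)^2 + (p 1)^2) / (2 * c) \<le> K"
proof -
  define a b where "a = p 0" and "b = p 1"
  have ab: "a \<ge> 0" "b \<ge> 0"
    using nonneg by (auto simp: a_def b_def)
  \<comment> \<open>Otherwise the upper bound on \<open>c\<close> is a quotient by 0, hence 0,
    contradicting \<open>0 < c\<close>.\<close>
  have "a + b \<noteq> 0"
    using c by (metis a_def b_def div_by_0 mult_zero_right not_le)
  with ab have "a + b > 0" by linarith
  then have q: "a^2 + b^2 > 0"
    using ab by (auto simp: sum_power2_gt_zero_iff)
  define r where "r = (a^2 + b^2) / (a + b)"
  have "r > 0"
    using q \<open>a + b > 0\<close> by (simp add: r_def)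
  have "c \<le> r / 2"
    using c(3) by (simp only: r_def a_def b_def divide_divide_eq_left mult.commute)
  have "a + b \<le> K"
  proof -
    have "\<bar>c - a * (a / (a + b)) - b * (1 - a / (a + b))\<bar> \<le> K / 2 * ((a / (a + b))^2 + (1 - a / (a + b))^2)"
      unfolding a_def b_def c(1)
      by (rule lipschitz_derivative_split_bound[OF H lip])
        (use ab \<open>a + b > 0\<close> in \<open>auto simp: a_def b_def\<close>)
    moreover have "1 - a / (a + b) = b / (a + b)"
      using \<open>a + b > 0\<close> by (simp add: field_simps)
    moreover have "a * (a / (a + b)) + b * (b / (a + b)) = r"
      by (simp add: r_def power2_eq_square add_divide_distrib)
    moreover have "(a / (a + b))^2 + (b / (a + b))^2 = r / (a + b)"
      by (simp add: r_def power_divide add_divide_distrib power2_eq_square)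
    ultimately have "r - c \<le> K / 2 * (r / (a + b))"
      by (simp only:)
    moreover have "K / 2 * (r / (a + b)) = r * (K / (a + b)) / 2"
      by (simp only: divide_inverse mult_ac)
    ultimately have "r - c \<le> r * (K / (a + b)) / 2"
      by (simp only:)
    moreover have "r * 1 \<le> z" if "r - c \<le> z / 2" for z
      using that \<open>c \<le> r / 2\<close> by simp
    ultimately have "r * 1 \<le> r * (K / (a + b))"
      by blast
    then have "1 \<le> K / (a + b)"
      using \<open>r > 0\<close> by (simp only: mult_le_cancel_left_pos)
    then show ?thesis
      using \<open>a + b > 0\<close> by simp
  qed
  with \<open>a + b > 0\<close> have "K > 0" by linarith
  \<comment> \<open>These are the points where a derivative of slope -K starting at a, or of slope K
    ending at b, is 0; they maximize the two Taylor lower bounds.\<close>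
  define s t where "s = a / K" and "t = 1 - b / K"
  have st: "0 \<le> s" "s \<le> t" "t \<le> 1"
    using ab \<open>a + b \<le> K\<close> \<open>K > 0\<close> by (auto simp: s_def t_def field_simps)
  have "\<bar>(H s - H 0) - a * s\<bar> \<le> K / 2 * s^2"
    using lipschitz_derivative_quadratic_bounds[OF H lip, of 0 s] st by (simp add: a_def)
  then have "a * s - K / 2 * s^2 \<le> H s - H 0"
    by (simp only: abs_le_iff) linarith
  moreover have "\<bar>(H t - H 1) + b * (1 - t)\<bar> \<le> K / 2 * (t - 1)^2"
    using lipschitz_derivative_quadratic_bounds[OF H lip, of 1 t] st by (simp add: b_def algebra_simps)
  then have "b * (1 - t) - K / 2 * (t - 1)^2 \<le> H 1 - H t"
    by (simp only: abs_le_iff) linarith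
  moreover have "H s \<le> H t"
  proof (rule DERIV_nonneg_imp_increasing_open[OF st(2)])
    fix x assume "s < x" "x < t"
    then have "x \<in> {0<..<1}" using st by auto
    then show "\<exists>y. (H has_real_derivative y) (at x) \<and> y \<ge> 0"
      using H[of x] at_within_interior[of x "{0..1}"] nonneg[of x] by auto
  next
    show "continuous_on {s..t} H"
      by (rule continuous_on_subset[OF DERIV_continuous_on[OF H]]) (use st in auto)
  qed
  moreover have "a * s - K / 2 * s^2 = a^2 / (2 * K)" "b * (1 - t) - K / 2 * (t - 1)^2 = b^2 / (2 * K)"
    using \<open>K > 0\<close> by (simp_all add: s_def t_def field_simps power2_eq_square)
  ultimately have "a^2 / (2 * K) + b^2 / (2 * K) \<le> c"
    by (simp add: c(1))
  then show ?thesis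
    using \<open>K > 0\<close> \<open>0 < c\<close> by (simp add: field_simps a_def[symmetric] b_def[symmetric])
qed

section \<open>Transfer of the lower bounds to the infimum\<close>

text \<open>Every real bound on a function representing H'' is a Lipschitz constant of H', hence at
  least \<open>V\<close>. If no function represents H'', the infimum is infinite.\<close>

lemma le_Linf_second_deriv:
  assumes "admissible a b c H"
    and "\<And>K. K-lipschitz_on {0..1} (deriv01 H) \<Longrightarrow> V \<le> K"
  shows "ereal V \<le> Linf_second_deriv H"
proof -
  obtain L where L: "L-lipschitz_on {0..1} (deriv01 H)"
    using admissibleD(2)[OF assms(1)] by blast
  show ?thesis
    unfolding Linf_second_deriv_def
  proof (rule Inf_greatest, clarify)
    fix g assume g: "second_distributional_deriv H g"
    show "ereal V \<le> Linf_norm g"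
    proof (rule ereal_le_real)
      fix K assume "Linf_norm g \<le> ereal K"
      then show "ereal V \<le> ereal K"
        using lipschitz_of_second_distributional_deriv[OF admissibleD(1)[OF assms(1)] L g]
        by (auto intro: assms(2))
    qed
  qed
qed

lemma le_Mstar_large:
  "ereal (\<bar>2 * c - a - b\<bar> + sqrt ((2 * c - a - b)^2 + (b - a)^2)) \<le> Mstar a b c"
  unfolding Mstar_def
proof (rule Inf_greatest, clarify)
  fix H assume adm: "admissible a b c H"
  then have eqs: "H 0 = 0" "H 1 = c" "deriv01 H 0 = a" "deriv01 H 1 = b"
    by (auto simp: admissible_def)
  show "ereal (\<bar>2 * c - a - b\<bar> + sqrt ((2 * c - a - b)^2 + (b - a)^2)) \<le> Linf_second_deriv H"
    by (rule le_Linf_second_deriv[OF adm])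
      (rule lipschitz_derivative_lower_bound_large[OF admissibleD(1)[OF adm]], use eqs in auto)
qed

lemma le_Mstar_small:
  assumes "0 < c" "c \<le> (a^2 + b^2) / (2 * (a + b))"
  shows "ereal ((a^2 + b^2) / (2 * c)) \<le> Mstar a b c"
  unfolding Mstar_def
proof (rule Inf_greatest, clarify)
  fix H assume adm: "admissible a b c H"
  then have eqs: "H 0 = 0" "H 1 = c" "deriv01 H 0 = a" "deriv01 H 1 = b"
    and nonneg: "\<And>x. x \<in> {0..1} \<Longrightarrow> 0 \<le> deriv01 H x"
    by (auto simp: admissible_def)
  show "ereal ((a^2 + b^2) / (2 * c)) \<le> Linf_second_deriv H"
  proof (rule le_Linf_second_deriv[OF adm])
    fix K assume "K-lipschitz_on {0..1} (deriv01 H)"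
    from lipschitz_derivative_lower_bound_small[OF admissibleD(1)[OF adm] this nonneg, of c]
    show "(a^2 + b^2) / (2 * c) \<le> K"
      using eqs assms by simp
  qed
qed

section \<open>Piecewise quadratic functions\<close>

text \<open>The two closed half-lines cover the line, and at their common point the values and the
  slopes agree.\<close>

lemma glue_has_real_derivative:
  fixes f1 f2 :: "real \<Rightarrow> real"
  assumes "\<And>x. (f1 has_real_derivative f1' x) (at x)" "\<And>x. (f2 has_real_derivative f2' x) (at x)"
    and "f1 \<tau> = f2 \<tau>" "f1' \<tau> = f2' \<tau>"
  shows "((\<lambda>t. if t \<le> \<tau> then f1 t else f2 t) has_real_derivative (if x \<le> \<tau> then f1' x else f2' x)) (at x)"
proof -
  have "((\<lambda>t. if t \<in> {..\<tau>} then f1 t else f2 t) has_vector_derivative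
      (if x \<in> {..\<tau>} then f1' x else f2' x)) (at x within {..\<tau>} \<union> {\<tau>..})"
    by (rule has_vector_derivative_If_within_closures[where T="{\<tau>..}"])
      (use assms in \<open>auto simp flip: has_real_derivative_iff_has_vector_derivative
        intro: has_field_derivative_at_within\<close>)
  moreover have "{..\<tau>} \<union> {\<tau>..} = (UNIV :: real set)" by auto
  ultimately show ?thesis
    by (simp add: has_real_derivative_iff_has_vector_derivative)
qed

text \<open>Two integrations by parts: the first uses G' = p everywhere, the second p' = g off the
  finite set \<open>S\<close>.\<close>

lemma second_distributional_derivI:
  fixes G p g :: "real \<Rightarrow> real"
  assumes G: "\<And>x. (G has_real_derivative p x) (at x)" and lip: "L-lipschitz_on {0..1} p"
    and "finite S" and g: "\<And>x. x \<in> {0<..<1} - S \<Longrightarrow> (p has_real_derivative g x) (at x)"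
    and meas: "g \<in> borel_measurable borel" and bound: "\<And>x. \<bar>g x\<bar> \<le> V"
  shows "second_distributional_deriv G g"
proof -
  \<comment> \<open>Used with h = 1 for local integrability and with h = \<phi> for the pairing with
    a test function.\<close>
  have integrable: "set_integrable lborel A (\<lambda>t. g t * h t)"
    if "A \<in> sets lborel" "A \<subseteq> {0..1}" "continuous_on {0..1} h" for A and h :: "real \<Rightarrow> real"
  proof -
    have "set_integrable lborel {0..1} (\<lambda>t. g t * h t)"
    proof -
      have "set_integrable lborel {0..1} h"
        by (rule borel_integrable_atLeastAtMost'[OF that(3)])
      then have "integrable lborel (\<lambda>t. V * (indicator {0..1} t *\<^sub>R h t))"
        unfolding set_integrable_def by (rule integrable_mult_right)
      then have "integrable lborel (\<lambda>t. g t * (indicator {0..1} t *\<^sub>R h t))"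
      proof (rule Bochner_Integration.integrable_bound)
        show "(\<lambda>t. g t * (indicator {0..1} t *\<^sub>R h t)) \<in> borel_measurable lborel"
          using meas borel_measurable_continuous_on_indicator[OF _ that(3)] by (auto intro!: borel_measurable_times)
        show "AE t in lborel. norm (g t * (indicator {0..1} t *\<^sub>R h t)) \<le> norm (V * (indicator {0..1} t *\<^sub>R h t))"
          using bound by (intro AE_I2) (auto simp: abs_mult intro!: mult_right_mono order_trans[OF bound abs_ge_self])
      qed
      then show ?thesis
        by (simp add: set_integrable_def mult.left_commute)
    qed
    then show ?thesis
      using set_integrable_subset that by blast
  qed
  have "locally_integrable g"
    unfolding locally_integrable_def
  proof (intro allI impI)
    fix A :: "real set" assume A: "compact A \<and> A \<subseteq> {0<..<1}"
    then have "A \<in> sets lborel"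
      by (simp add: borel_compact)
    then show "set_integrable lborel A g"
      using integrable[of A "\<lambda>_. 1"] A by force
  qed
  moreover have "(LINT t:{0<..<1}|lborel. G t * deriv (deriv \<phi>) t) = (LINT t:{0<..<1}|lborel. g t * \<phi> t)"
    if \<phi>: "test_function \<phi>" for \<phi>
  proof -
    note D = test_function_derivs[OF \<phi>]
    have cp: "continuous_on {0..1} p"
      by (rule lipschitz_on_continuous_on[OF lip])
    have "((\<lambda>t. p t * deriv \<phi> t + g t * \<phi> t) has_integral 0) {0..1}"
      by (rule has_integral_product_rule_0[OF \<open>finite S\<close> cp g D(1)])
        (simp_all add: test_function_boundary[OF \<phi>])
    moreover have "(\<lambda>t. p t * deriv \<phi> t) integrable_on {0..1}"
      by (intro integrable_continuous_real continuous_on_mult cp D)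
    moreover have int: "set_integrable lborel {0..1} (\<lambda>t. g t * \<phi> t)"
      by (intro integrable D) auto
    then have "(\<lambda>t. g t * \<phi> t) integrable_on {0..1}"
      by (rule set_borel_integral_eq_integral)
    ultimately have "integral {0..1} (\<lambda>t. p t * deriv \<phi> t) + integral {0..1} (\<lambda>t. g t * \<phi> t) = 0"
      by (metis Henstock_Kurzweil_Integration.integral_add integral_unique)
    then show ?thesis
      using integral_second_deriv_test_function[OF has_field_derivative_at_within[OF G] cp \<phi>]
        LINT_Ioo_eq_integral[OF int] by linarith
  qed
  ultimately show ?thesis
    by (auto simp: second_distributional_deriv_def)
qed

lemma Linf_second_deriv_le:
  assumes "second_distributional_deriv G g" and "g \<in> borel_measurable borel" and "\<And>x. \<bar>g x\<bar> \<le> V"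
  shows "Linf_second_deriv G \<le> ereal V"
proof -
  have "Linf_norm g \<le> ereal V"
    unfolding Linf_norm_def
  proof (rule esssup_I)
    have "g \<in> borel_measurable (restrict_space lborel {0..1})"
      using assms(2) by (simp add: measurable_restrict_space1)
    then show "(\<lambda>t. ereal \<bar>g t\<bar>) \<in> borel_measurable (restrict_space lborel {0..1})"
      by measurable
  qed (use assms(3) in simp)
  moreover have "Linf_second_deriv G \<le> Linf_norm g"
    unfolding Linf_second_deriv_def using assms(1) by (auto intro!: Inf_lower)
  ultimately show ?thesis
    by (rule order_trans[rotated])
qed

lemma deriv01_eq:
  assumes "(G has_real_derivative p) (at x)" "x \<in> {0..1}"
  shows "deriv01 G x = p"
  unfolding deriv01_def
  using assms
  by (auto simp: has_real_derivative_iff_has_vector_derivative intro!: vector_derivative_at_within_ivl)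

lemma admissibleI:
  assumes G: "\<And>x. (G has_real_derivative p x) (at x)" and lip: "L-lipschitz_on {0..1} p"
    and "G 0 = 0" "G 1 = c" "p 0 = a" "p 1 = b" "\<And>x. x \<in> {0..1} \<Longrightarrow> 0 \<le> p x"
  shows "admissible a b c G"
proof -
  have eq: "deriv01 G x = p x" if "x \<in> {0..1}" for x
    using deriv01_eq[OF G that] .
  have "L-lipschitz_on {0..1} (deriv01 G)"
    using lipschitz_on_transform[OF lip] eq by simp
  moreover have "G differentiable_on {0..1}"
    using G by (auto simp: differentiable_on_def real_differentiable_def intro: has_field_derivative_at_within)
  ultimately show ?thesis
    using assms eq by (auto simp: admissible_def C11_def)
qed

text \<open>The chain \<open>Mstar a b c\<close> \<le> \<open>Linf_second_deriv G\<close> \<le>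
  \<open>V\<close> \<le> \<open>Mstar a b c\<close> closes up.\<close>

lemma Mstar_eqI:
  assumes adm: "admissible a b c G" and upper: "Linf_second_deriv G \<le> V" and lower: "V \<le> Mstar a b c"
  shows "Mstar a b c = V" "Linf_second_deriv G = V"
proof -
  have "Mstar a b c \<le> Linf_second_deriv G"
    unfolding Mstar_def using adm by (auto intro!: Inf_lower)
  with upper lower show "Mstar a b c = V" "Linf_second_deriv G = V"
    by auto
qed

section \<open>The two-piece and three-piece profiles\<close>

text \<open>A negative \<open>W\<close> is allowed, so that \<open>G_middle\<close> is covered with
  \<open>W = - M\<close>. The bound on |b - a| places the junction in [0, 1], the quadratic equation
  makes the two pieces meet there when \<open>W \<noteq> 0\<close>, and (W + a + b)/2 is the slope
  at the junction. For \<open>W = 0\<close> the quadratic equation carries no information about c,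
  whence \<open>W0\<close>.\<close>

lemma G_upper_properties:
  fixes a b c W :: real
  assumes "a \<ge> 0" "b \<ge> 0" "\<bar>b - a\<bar> \<le> \<bar>W\<bar>" "0 \<le> W + a + b"
    and W: "W^2 - 2 * (2 * c - a - b) * W = (b - a)^2" and W0: "W = 0 \<Longrightarrow> 2 * c = a + b"
  shows "admissible a b c (G_upper W a b c)" "Linf_second_deriv (G_upper W a b c) \<le> ereal \<bar>W\<bar>"
proof -
  define \<tau> where "\<tau> = 1/2 + (b - a) / (2 * W)"
  define f1 where "f1 t = W/2 * t^2 + a * t" for t
  define f2 where "f2 t = - (W/2) * t^2 + (W + b) * t + (c - b - W/2)" for t
  define p where "p x = (if x \<le> \<tau> then W * x + a else - W * x + (W + b))" for x
  define g where "g x = (if x \<le> \<tau> then W else - W)" for x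
  have G_eq: "G_upper W a b c = (\<lambda>t. if t \<le> \<tau> then f1 t else f2 t)"
    by (rule ext) (simp add: G_upper_def \<tau>_def f1_def f2_def Let_def)
  \<comment> \<open>For \<open>W = 0\<close> the quotient is 0 by convention, \<open>a = b\<close>,
    and the junction lies at 1/2.\<close>
  have \<tau>: "0 \<le> \<tau>" "\<tau> \<le> 1" "2 * (W * \<tau>) = W + b - a"
  proof -
    have "\<bar>(b - a) / W\<bar> \<le> 1"
      using assms(3) by (cases "W = 0") (auto simp: abs_divide)
    moreover have "\<tau> = 1/2 + (b - a) / W / 2"
      by (simp add: \<tau>_def)
    ultimately show "0 \<le> \<tau>" "\<tau> \<le> 1"
      by (simp_all only: abs_le_iff) auto
    show "2 * (W * \<tau>) = W + b - a"
      using assms(3) by (cases "W = 0") (auto simp: \<tau>_def field_simps)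
  qed
  have f_eq: "f1 \<tau> = f2 \<tau>"
  proof (cases "W = 0")
    case True
    then show ?thesis using assms(3) W0 by (simp add: f1_def f2_def)
  next
    case False
    \<comment> \<open>The factor 4 W turns the jump into a polynomial in 2 W \<tau>, whose value is
      known.\<close>
    have "4 * W * (f1 \<tau> - f2 \<tau>) = (2 * (W * \<tau>))^2 - 2 * (W + b - a) * (2 * (W * \<tau>)) - 4 * W * (c - b - W / 2)"
      by (simp add: f1_def f2_def algebra_simps power2_eq_square)
    also have "\<dots> = W^2 - 2 * (2 * c - a - b) * W - (b - a)^2"
      unfolding \<tau>(3) by (simp add: algebra_simps power2_eq_square)
    finally show ?thesis using W False by simp
  qed
  have G: "(G_upper W a b c has_real_derivative p x) (at x)" for x
    unfolding G_eq p_def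
    by (rule glue_has_real_derivative)
      (use \<tau> f_eq in \<open>auto simp: f1_def f2_def intro!: derivative_eq_intros\<close>)
  have lip: "\<bar>W\<bar>-lipschitz_on {0..1} p"
    unfolding p_def
    by (rule lipschitz_on_concat)
      (use \<tau> in \<open>auto intro!: lipschitz_onI simp: dist_real_def abs_mult abs_minus_commute simp flip: right_diff_distrib\<close>)
  show "admissible a b c (G_upper W a b c)"
  proof (rule admissibleI[OF G lip])
    show "G_upper W a b c 0 = 0" "p 0 = a"
      using \<tau> by (simp_all add: G_eq f1_def p_def)
    \<comment> \<open>If \<open>\<tau> = 1\<close>, the first branch is evaluated at 1; there it
      agrees with the second.\<close>
    have "G_upper W a b c 1 = f2 1"
      unfolding G_eq using \<tau> f_eq by (cases "\<tau> = 1") auto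
    then show "G_upper W a b c 1 = c"
      by (simp add: f2_def)
    show "p 1 = b"
      using \<tau> by (cases "\<tau> = 1") (auto simp: p_def)
    fix x :: real assume x: "x \<in> {0..1}"
    \<comment> \<open>For W \<ge> 0 the slope is at least a on the left piece and at least b on the
      right one; for W < 0 it is smallest at the junction.\<close>
    show "0 \<le> p x"
    proof (cases "W \<ge> 0")
      case True
      then have "0 \<le> W * x" "W * x \<le> W * 1"
        using x by (simp, intro mult_left_mono) auto
      then show ?thesis
        using assms(1,2) by (simp add: p_def)
    next
      case False
      then have "W * \<tau> \<le> W * x" if "x \<le> \<tau>"
        using that by (intro mult_left_mono_neg) auto
      moreover have "W * x \<le> W * \<tau>" if "x > \<tau>"
        using that False by (intro mult_left_mono_neg) auto
      ultimately show ?thesis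
        using \<tau>(3) assms(4) by (auto simp: p_def)
    qed
  qed
  have meas: "g \<in> borel_measurable borel"
    unfolding g_def[abs_def] by measurable
  have "second_distributional_deriv (G_upper W a b c) g"
  proof (rule second_distributional_derivI[OF G lip, where S="{\<tau>}"])
    fix x :: real assume x: "x \<in> {0<..<1} - {\<tau>}"
    have d: "((\<lambda>x. W * x + a) has_real_derivative W) (at x)"
      "((\<lambda>x. - W * x + (W + b)) has_real_derivative - W) (at x)"
      by (auto intro!: derivative_eq_intros)
    consider "x < \<tau>" | "x > \<tau>" using x by fastforce
    then show "(p has_real_derivative g x) (at x)"
    proof cases
      case 1
      then show ?thesis
        using has_field_derivative_transform_within_open[OF d(1), of "{..<\<tau>}" p]
        by (auto simp: p_def g_def)
    next
      case 2
      then show ?thesis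
        using has_field_derivative_transform_within_open[OF d(2), of "{\<tau><..}" p]
        by (auto simp: p_def g_def)
    qed
  qed (auto simp: g_def intro: meas)
  then show "Linf_second_deriv (G_upper W a b c) \<le> ereal \<bar>W\<bar>"
    by (rule Linf_second_deriv_le) (auto simp: g_def intro: meas)
qed

lemma G_middle_eq_G_upper: "G_middle M a b c = G_upper (- M) a b c"
  by (rule ext) (simp add: G_middle_def G_upper_def Let_def)

text \<open>The slope falls from a to 0 at rate M, rests at 0, and rises to b at rate M. The
  inequality a + b \<le> M puts the junctions in order, the pieces meet by the choice of the
  junctions, and the equation for c fixes the value at 1.\<close>

lemma G_lower_properties:
  fixes a b c M :: real
  assumes "a \<ge> 0" "b \<ge> 0" "M > 0" "a + b \<le> M" and c: "2 * M * c = a^2 + b^2"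
  shows "admissible a b c (G_lower M a b)" "Linf_second_deriv (G_lower M a b) \<le> ereal M"
proof -
  define \<tau>1 \<tau>2 where "\<tau>1 = a / M" and "\<tau>2 = 1 - b / M"
  define f1 where "f1 t = - (M/2) * t^2 + a * t" for t
  define f2 where "f2 t = a^2 / (2 * M)" for t :: real
  define f3 where "f3 t = M/2 * (t - 1)^2 + b * (t - 1) + (a^2 + b^2) / (2 * M)" for t
  define q where "q x = (if x \<le> \<tau>2 then 0 else M * (x - 1) + b)" for x
  define p where "p x = (if x \<le> \<tau>1 then - M * x + a else q x)" for x
  define g where "g x = (if x \<le> \<tau>1 then - M else if x \<le> \<tau>2 then 0 else M)" for x
  have G_eq: "G_lower M a b = (\<lambda>t. if t \<le> \<tau>1 then f1 t else if t \<le> \<tau>2 then f2 t else f3 t)"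
    by (rule ext) (simp add: G_lower_def \<tau>1_def \<tau>2_def f1_def f2_def f3_def Let_def)
  have \<tau>: "0 \<le> \<tau>1" "\<tau>1 \<le> \<tau>2" "\<tau>2 \<le> 1" "M * \<tau>1 = a" "M * (\<tau>2 - 1) = - b"
    using assms by (auto simp: \<tau>1_def \<tau>2_def field_simps)
  have f12: "f1 \<tau>1 = f2 \<tau>1" and f23: "f2 \<tau>2 = f3 \<tau>2"
    using \<open>M > 0\<close> by (simp_all add: f1_def f2_def f3_def \<tau>1_def \<tau>2_def field_simps power2_eq_square)
  have "((\<lambda>t. if t \<le> \<tau>2 then f2 t else f3 t) has_real_derivative q x) (at x)" for x
    unfolding q_def
    by (rule glue_has_real_derivative)
      (use \<tau> f23 in \<open>auto simp: f2_def f3_def intro!: derivative_eq_intros\<close>)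
  then have G: "(G_lower M a b has_real_derivative p x) (at x)" for x
    unfolding G_eq p_def
    by (rule glue_has_real_derivative[rotated])
      (use \<tau> f12 in \<open>auto simp: f1_def q_def intro!: derivative_eq_intros\<close>)
  \<comment> \<open>The right-hand junction is treated first, following the nesting of the
    conditionals.\<close>
  have "M-lipschitz_on {\<tau>1..1} q"
    unfolding q_def
    by (rule lipschitz_on_concat)
      (use \<tau> \<open>M > 0\<close> in \<open>auto intro!: lipschitz_onI simp: dist_real_def abs_mult simp flip: right_diff_distrib\<close>)
  then have lip: "M-lipschitz_on {0..1} p"
    unfolding p_def
    by (intro lipschitz_on_concat)
      (use \<tau> \<open>M > 0\<close> in \<open>auto intro!: lipschitz_onI simp: q_def dist_real_def abs_mult abs_minus_commute simp flip: right_diff_distrib\<close>)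
  show "admissible a b c (G_lower M a b)"
  proof (rule admissibleI[OF G lip])
    show "G_lower M a b 0 = 0" "p 0 = a"
      using \<tau> by (simp_all add: G_eq f1_def p_def)
    \<comment> \<open>For b = 0 the last piece shrinks to the point 1, which then falls to an
      earlier branch with the same value.\<close>
    have "G_lower M a b 1 = f3 1"
      unfolding G_eq using \<tau> f12 f23 by (cases "\<tau>1 = 1"; cases "\<tau>2 = 1") auto
    moreover have "c = (a^2 + b^2) / (2 * M)"
      using c \<open>M > 0\<close> by (simp add: field_simps)
    ultimately show "G_lower M a b 1 = c"
      by (simp add: f3_def)
    show "p 1 = b"
      using \<tau> by (cases "\<tau>1 = 1"; cases "\<tau>2 = 1") (auto simp: p_def q_def)
    fix x :: real assume "x \<in> {0..1}"
    have "M * x \<le> M * \<tau>1" if "x \<le> \<tau>1"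
      using that \<open>M > 0\<close> by (intro mult_left_mono) auto
    moreover have "M * (\<tau>2 - 1) \<le> M * (x - 1)" if "x > \<tau>2"
      using that \<open>M > 0\<close> by (intro mult_left_mono) auto
    ultimately show "0 \<le> p x"
      using \<tau> by (auto simp: p_def q_def)
  qed
  have meas: "g \<in> borel_measurable borel"
    unfolding g_def[abs_def] by measurable
  have "second_distributional_deriv (G_lower M a b) g"
  proof (rule second_distributional_derivI[OF G lip, where S="{\<tau>1, \<tau>2}"])
    fix x :: real assume x: "x \<in> {0<..<1} - {\<tau>1, \<tau>2}"
    have d: "((\<lambda>x. - M * x + a) has_real_derivative - M) (at x)" "((\<lambda>x. 0) has_real_derivative 0) (at x)"
      "((\<lambda>x. M * (x - 1) + b) has_real_derivative M) (at x)"
      by (auto intro!: derivative_eq_intros)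
    consider "x < \<tau>1" | "\<tau>1 < x" "x < \<tau>2" | "x > \<tau>2" using x by fastforce
    then show "(p has_real_derivative g x) (at x)"
    proof cases
      case 1
      then show ?thesis
        using has_field_derivative_transform_within_open[OF d(1), of "{..<\<tau>1}" p] \<tau>(2)
        by (auto simp: p_def q_def g_def)
    next
      case 2
      then show ?thesis
        using has_field_derivative_transform_within_open[OF d(2), of "{\<tau>1<..<\<tau>2}" p] \<tau>(2)
        by (auto simp: p_def q_def g_def)
    next
      case 3
      then show ?thesis
        using has_field_derivative_transform_within_open[OF d(3), of "{\<tau>2<..}" p] \<tau>(2)
        by (auto simp: p_def q_def g_def)
    qed
  qed (use \<open>M > 0\<close> in \<open>auto simp: g_def intro: meas\<close>)
  then show "Linf_second_deriv (G_lower M a b) \<le> ereal M"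
    by (rule Linf_second_deriv_le) (use \<open>M > 0\<close> in \<open>auto simp: g_def intro: meas\<close>)
qed

section \<open>The value of the infimum and its attainment by the profiles\<close>

theorem theorem2p2:
  fixes a b c c0 M :: real
  assumes "a \<ge> 0" and "b \<ge> 0" and "c > 0"
    and c0_def: "c0 = (a^2 + b^2) / (2 * (a + b))"
    and M_def: "M = real_of_ereal (Mstar a b c)"
  shows "(c \<le> c0 \<longrightarrow> Mstar a b c = ereal ((a^2 + b^2) / (2 * c))) \<and>
         (c \<ge> c0 \<longrightarrow> Mstar a b c =
            ereal (\<bar>2 * c - a - b\<bar> + sqrt ((2 * c - a - b)^2 + (b - a)^2))) \<and>
         (c \<ge> (a + b) / 2 \<longrightarrow>
            admissible a b c (G_upper M a b c) \<and>
            Linf_second_deriv (G_upper M a b c) = Mstar a b c) \<and>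
         (c0 \<le> c \<and> c \<le> (a + b) / 2 \<longrightarrow>
            admissible a b c (G_middle M a b c) \<and>
            Linf_second_deriv (G_middle M a b c) = Mstar a b c) \<and>
         (0 < c \<and> c < c0 \<longrightarrow>
            admissible a b c (G_lower M a b) \<and>
            Linf_second_deriv (G_lower M a b) = Mstar a b c)"
proof -
  define e d r where "e = 2 * c - a - b" and "d = b - a" and "r = sqrt (e^2 + d^2)"
  define V1 V2 where "V1 = (a^2 + b^2) / (2 * c)" and "V2 = \<bar>e\<bar> + r"
  have r: "r^2 = e^2 + d^2" "r \<ge> 0" "\<bar>d\<bar> \<le> r"
    by (auto simp: r_def real_le_rsqrt)
  \<comment> \<open>\<open>V2\<close> is the larger root of X^2 - 2 |e| X - d^2; these facts feed
    the hypotheses of \<open>G_upper_properties\<close>.\<close>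
  have V2: "V2 \<ge> 0" "\<bar>b - a\<bar> \<le> V2" "V2 = 0 \<Longrightarrow> e = 0" "V2^2 - 2 * \<bar>e\<bar> * V2 = (b - a)^2"
    using r by (auto simp: V2_def d_def[symmetric] power2_sum algebra_simps power2_eq_square)
  then have V2_0: "2 * c = a + b" if "V2 = 0"
    using that by (simp add: e_def)
  have lower2: "ereal V2 \<le> Mstar a b c"
    using le_Mstar_large[of c a b] by (simp add: V2_def r_def e_def d_def)
  have small: "Mstar a b c = ereal V1" "admissible a b c (G_lower V1 a b)"
    "Linf_second_deriv (G_lower V1 a b) = ereal V1" if "c \<le> c0"
  proof -
    \<comment> \<open>If a + b = 0, then \<open>c0\<close> is 0 by the convention on division, which
      is below c.\<close>
    have "a + b \<noteq> 0"
      using that \<open>c > 0\<close> by (metis c0_def div_by_0 mult_zero_right not_le)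
    with assms(1,2) have ab: "a + b > 0" by linarith
    then have "a^2 + b^2 > 0"
      using assms(1,2) by (auto simp: sum_power2_gt_zero_iff)
    then have "V1 > 0" "2 * V1 * c = a^2 + b^2"
      using \<open>c > 0\<close> by (auto simp: V1_def)
    \<comment> \<open>This is \<open>c \<le> c0\<close> with c and a + b exchanged across the
      inequality.\<close>
    moreover have "a + b \<le> V1"
      using that ab \<open>c > 0\<close> by (simp add: V1_def c0_def field_simps)
    ultimately have G: "admissible a b c (G_lower V1 a b)" "Linf_second_deriv (G_lower V1 a b) \<le> ereal V1"
      using G_lower_properties[of a b V1 c] assms(1,2) by auto
    have "ereal V1 \<le> Mstar a b c"
      using le_Mstar_small[of c a b] that \<open>c > 0\<close> by (simp add: V1_def c0_def)
    from Mstar_eqI[OF G this] G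
    show "Mstar a b c = ereal V1" "admissible a b c (G_lower V1 a b)"
      "Linf_second_deriv (G_lower V1 a b) = ereal V1" by auto
  qed
  have upper: "Mstar a b c = ereal V2" "admissible a b c (G_upper V2 a b c)"
    "Linf_second_deriv (G_upper V2 a b c) = ereal V2" if "c \<ge> (a + b) / 2"
  proof -
    have "e \<ge> 0" using that by (simp add: e_def)
    then have G: "admissible a b c (G_upper V2 a b c)" "Linf_second_deriv (G_upper V2 a b c) \<le> ereal V2"
      using G_upper_properties[of a b V2 c] assms(1,2) V2 V2_0 by (auto simp: e_def)
    from Mstar_eqI[OF G lower2] G
    show "Mstar a b c = ereal V2" "admissible a b c (G_upper V2 a b c)"
      "Linf_second_deriv (G_upper V2 a b c) = ereal V2" by auto
  qed
  have middle: "Mstar a b c = ereal V2" "admissible a b c (G_middle V2 a b c)"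
    "Linf_second_deriv (G_middle V2 a b c) = ereal V2" if "c0 \<le> c" "c \<le> (a + b) / 2"
  proof -
    have "e \<le> 0" using that by (simp add: e_def)
    have "a + b > 0" using less_le_trans[OF \<open>c > 0\<close> that(2)] by simp
    \<comment> \<open>Since e^2 + d^2 = 4 c^2 - 4 c (a + b) + 2 (a^2 + b^2), the condition
      \<open>c0 \<le> c\<close> amounts to r \<le> 2 c. This yields V2 \<le> a + b, the
      nonnegativity of the slope at the junction.\<close>
    then have "a^2 + b^2 \<le> 2 * c * (a + b)"
      using that by (simp add: c0_def field_simps)
    then have "e^2 + d^2 \<le> (2 * c)^2"
      by (simp add: e_def d_def power2_eq_square algebra_simps)
    then have "r \<le> 2 * c"
      unfolding r_def using \<open>c > 0\<close> by (intro real_le_lsqrt) auto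
    then have "V2 \<le> a + b"
      using \<open>e \<le> 0\<close> by (simp add: V2_def e_def)
    \<comment> \<open>As e \<le> 0, replacing |e| by -e turns the equation for \<open>V2\<close>
      into the one required of \<open>W = - V2\<close>.\<close>
    have "\<bar>e\<bar> = - (2 * c - a - b)"
      using \<open>e \<le> 0\<close> by (simp add: e_def)
    then have "(- V2)^2 - 2 * (2 * c - a - b) * (- V2) = (b - a)^2"
      using V2(4) by (simp only: power2_minus)
    with \<open>V2 \<le> a + b\<close> have G: "admissible a b c (G_middle V2 a b c)" "Linf_second_deriv (G_middle V2 a b c) \<le> ereal V2"
      using G_upper_properties[of a b "- V2" c] assms(1,2) V2 V2_0 \<open>e \<le> 0\<close>
      by (auto simp: e_def G_middle_eq_G_upper)
    from Mstar_eqI[OF G lower2] G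
    show "Mstar a b c = ereal V2" "admissible a b c (G_middle V2 a b c)"
      "Linf_second_deriv (G_middle V2 a b c) = ereal V2" by auto
  qed
  have V2_eq: "V2 = \<bar>2 * c - a - b\<bar> + sqrt ((2 * c - a - b)^2 + (b - a)^2)"
    by (simp add: V2_def r_def e_def d_def)
  \<comment> \<open>The formula for \<open>c \<ge> c0\<close> comes from \<open>upper\<close> or
    from \<open>middle\<close>, according to the side of (a + b)/2 on which c lies.\<close>
  show ?thesis
    unfolding V2_eq[symmetric] V1_def[symmetric] M_def
    using small upper middle by (cases "c \<ge> (a + b) / 2") auto
qed

end
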